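(* Let $ns_1, ns_2$ be independent lenses ($ns_1\bowtie ns_2$) into the state space $\Sigma$ and $cs$ a set of events. For all state predicates $s_1,s_2$, functions $\sigma_1,\sigma_2:\Sigma\to\Sigma$, and trace expressions $t_1,t_2$: $\Phi(s_1,\sigma_1,t_1)\bowtie_F^{ns_1,cs,ns_2}\Phi(s_2,\sigma_2,t_2) = \exists t\bullet\Phi(s_1\wedge s_2\wedge t\in t_1\parallel_{cs}t_2\wedge t_1\restriction cs = t_2\restriction cs,\ \sigma_1[ns_1|ns_2]\sigma_2,\ t)$, and $\Phi(s_1,\sigma_1,\langle\rangle)\bowtie_F^{ns_1,cs,ns_2}\Phi(s_2,\sigma_2,\langle\rangle) = \Phi(s_1\wedge s_2,\ \sigma_1[ns_1|ns_2]\sigma_2,\ \langle\rangle)$.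
   Context: UTP setting: relations are predicates over undashed (initial) and dashed (final) variables; $;$ is relational composition; $P\lhd c\rhd Q=(c\wedge P)\vee(\neg c\wedge Q)$. Observational variables: booleans $ok,ok',wait,wait'$; traces $tr,tr'$ (finite event sequences; $\le$ prefix, ${}^\frown$ concatenation, $-$ removal of a prefix); state $st,st'\in\Sigma$; refusal sets $ref,ref'$; $tt$ abbreviates $tr'-tr$. $\mathbf{R1}(P) = P\wedge tr\le tr'$; $\mathbf{R2}(P) = P[\langle\rangle,tr'-tr/tr,tr']\lhd tr\le tr'\rhd P$; $\mathbf{RR}(P) = \exists ok,ok',wait,wait'\bullet\mathbf{R1}(\mathbf{R2}(P))$; $\mathbf{CRR}(P) = \exists ref\bullet\mathbf{RR}(P)$. For a state predicate $s$, a trace-valued expression $t$ over $st$, and $\sigma:\Sigma\to\Sigma$: $\Phi(s,\sigma,t) = \mathbf{CRR}(s\wedge st'=\sigma(st)\wedge tt=t)$. Lenses: a lens $X:V\Rightarrow\Sigma$ is a pair $get_X:\Sigma\to V$, $put_X:\Sigma\to V\to\Sigma$ with $get(put\,s\,v) = v$, $put(put\,s\,v')\,v = put\,s\,v$, $put\,s\,(get\,s) = s$; $X\bowtie Y$ iff $put_X(put_Y\,s\,v)\,u = put_Y(put_X\,s\,u)\,v$ for all $s,u,v$. Override $s_1\oplus_X s_2 = put_X\,s_1\,(get_X\,s_2)$. State-update merge: $(\sigma_1[ns_1|ns_2]\sigma_2)(x) = (x\oplus_{ns_1}\sigma_1(x))\oplus_{ns_2}\sigma_2(x)$. Parallel-by-merge: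 $P\parallel_M Q = (P_0\wedge Q_1\wedge v'=v);M$, with $v$ the tuple of all variables, $P_0$ ($Q_1$) obtained from $P$ ($Q$) by renaming each dashed $x'$ to $0.x$ ($1.x$), and $M$ relating $x,0.x,1.x$ to $x'$. Trace merge $\parallel_{cs}$: least function from pairs of event sequences to sets of sequences with $\langle\rangle\parallel_{cs}\langle\rangle=\{\langle\rangle\}$; $(e{:}u)\parallel_{cs}\langle\rangle$ and $\langle\rangle\parallel_{cs}(e{:}u)$ equal $\{\langle\rangle\}$ if $e\in cs$, otherwise $\{\langle e\rangle\}{}^\frown(u\parallel_{cs}\langle\rangle)$, resp. $\{\langle e\rangle\}{}^\frown(\langle\rangle\parallel_{cs}u)$; $(e{:}u_1)\parallel_{cs}(e{:}u_2) = \{\langle e\rangle\}{}^\frown(u_1\parallel_{cs}u_2)$ if $e\in cs$, else $\{\langle e\rangle\}{}^\frown(u_1\parallel_{cs}(e{:}u_2)\cup(e{:}u_1)\parallel_{cs}u_2)$; for $e_1\neq e_2$: $\{\langle\rangle\}$ if both in $cs$, $\{\langle e_2\rangle\}{}^\frown((e_1{:}u_1)\parallel_{cs}u_2)$ if only $e_1\in cs$, $\{\langle e_1\rangle\}{}^\frown(u_1\parallel_{cs}(e_2{:}u_2))$ if only $e_2\in cs$, and the union of these two if neither. $S{}^\frown T = \{a{}^\frown b\mid a\in S,b\in T\}$; $u\restriction cs$ is the subsequence of elements of $u$ in $cs$. Merge: $N(ns_1,cs,ns_2) = (tt\in0.tt\parallel_{cs}1.tt\wedge0.tt\restriction cs =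 1.tt\restriction cs\wedge ref'\subseteq((0.ref\cup1.ref)\cap cs)\cup((0.ref\cap1.ref)\setminus cs)\wedge st' = (st\oplus_{ns_1}0.st)\oplus_{ns_2}1.st)$, $0.tt = 0.tr-tr$, $1.tt = 1.tr-tr$; final merge $P\bowtie_F^{ns_1,cs,ns_2}Q = P\parallel_{\exists ref'\bullet N(ns_1,cs,ns_2)}Q$. *)

theory Defs
  imports Main "HOL-Library.Sublist"
begin

section \<open>Observations and relations\<close>

record ('s, 'e) obs =
  ok :: bool
  wait :: bool
  tr :: "'e list"
  st :: 's
  ref :: "'e set"

text \<open>A predicate over undashed and dashed variables is a relation \<open>P x x'\<close>, where \<open>x\<close> collects the
  undashed and \<open>x'\<close> the dashed variables; the relational composition \<open>;\<close> is the library's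
  composition (OO) of binary predicates.\<close>

type_synonym ('s, 'e) rel = "('s, 'e) obs \<Rightarrow> ('s, 'e) obs \<Rightarrow> bool"

definition ucond ::
  "('s, 'e) rel \<Rightarrow> ('s, 'e) rel \<Rightarrow> ('s, 'e) rel \<Rightarrow> ('s, 'e) rel"  ("(_ \<triangleleft> _ \<triangleright> _)" [52, 0, 53] 52)
  where "(P \<triangleleft> c \<triangleright> Q) = (\<lambda>x x'. (c x x' \<and> P x x') \<or> (\<not> c x x' \<and> Q x x'))"

text \<open>Removal of the prefix \<open>u\<close> from \<open>w\<close>. Mathematically this is undefined unless \<open>u\<close> is a prefix of
  \<open>w\<close>; the value of the total HOL function outside this domain is never relied on.\<close>

definition trace_minus :: "'e list \<Rightarrow> 'e list \<Rightarrow> 'e list"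
  where "trace_minus w u = drop (length u) w"

definition tt :: "('s, 'e) obs \<Rightarrow> ('s, 'e) obs \<Rightarrow> 'e list"
  where "tt x x' = trace_minus (tr x') (tr x)"

section \<open>Healthiness conditions\<close>

definition R1 :: "('s, 'e) rel \<Rightarrow> ('s, 'e) rel"
  where "R1 P = (\<lambda>x x'. P x x' \<and> prefix (tr x) (tr x'))"

definition R2 :: "('s, 'e) rel \<Rightarrow> ('s, 'e) rel"
  where "R2 P = ((\<lambda>x x'. P (x\<lparr>tr := []\<rparr>) (x'\<lparr>tr := trace_minus (tr x') (tr x)\<rparr>))
                 \<triangleleft> (\<lambda>x x'. prefix (tr x) (tr x')) \<triangleright> P)"

definition RR :: "('s, 'e) rel \<Rightarrow> ('s, 'e) rel"
  where "RR P = (\<lambda>x x'. \<exists>b b' w w'.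
           R1 (R2 P) (x\<lparr>ok := b, wait := w\<rparr>) (x'\<lparr>ok := b', wait := w'\<rparr>))"

definition CRR :: "('s, 'e) rel \<Rightarrow> ('s, 'e) rel"
  where "CRR P = (\<lambda>x x'. \<exists>r. RR P (x\<lparr>ref := r\<rparr>) x')"

definition Phi :: "('s \<Rightarrow> bool) \<Rightarrow> ('s \<Rightarrow> 's) \<Rightarrow> ('s \<Rightarrow> 'e list) \<Rightarrow> ('s, 'e) rel"  ("\<Phi>")
  where "\<Phi> s \<sigma> t = CRR (\<lambda>x x'. s (st x) \<and> st x' = \<sigma> (st x) \<and> tt x x' = t (st x))"

section \<open>Lenses\<close>

record ('v, 's) lens =
  lget :: "'s \<Rightarrow> 'v"
  lput :: "'s \<Rightarrow> 'v \<Rightarrow> 's"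

definition is_lens :: "('v, 's) lens \<Rightarrow> bool"
  where "is_lens X \<longleftrightarrow>
           (\<forall>s v. lget X (lput X s v) = v) \<and>
           (\<forall>s v v'. lput X (lput X s v') v = lput X s v) \<and>
           (\<forall>s. lput X s (lget X s) = s)"

definition lens_indep :: "('u, 's) lens \<Rightarrow> ('v, 's) lens \<Rightarrow> bool"  (infix "\<bowtie>" 50)
  where "X \<bowtie> Y \<longleftrightarrow> (\<forall>s u v. lput X (lput Y s v) u = lput Y (lput X s u) v)"

definition lens_override :: "'s \<Rightarrow> ('v, 's) lens \<Rightarrow> 's \<Rightarrow> 's"
  where "lens_override a X b = lput X a (lget X b)"

definition st_merge ::
  "('u, 's) lens \<Rightarrow> ('v, 's) lens \<Rightarrow> ('s \<Rightarrow> 's) \<Rightarrow> ('s \<Rightarrow> 's) \<Rightarrow> 's \<Rightarrow> 's"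
  where "st_merge ns\<^sub>1 ns\<^sub>2 \<sigma>\<^sub>1 \<sigma>\<^sub>2 =
           (\<lambda>x. lens_override (lens_override x ns\<^sub>1 (\<sigma>\<^sub>1 x)) ns\<^sub>2 (\<sigma>\<^sub>2 x))"

section \<open>Trace merge\<close>

definition set_concat :: "'e list set \<Rightarrow> 'e list set \<Rightarrow> 'e list set"  (infixr "\<frown>" 75)
  where "S \<frown> T = {a @ b | a b. a \<in> S \<and> b \<in> T}"

fun trace_merge :: "'e list \<Rightarrow> 'e set \<Rightarrow> 'e list \<Rightarrow> 'e list set"  ("(_ \<parallel>\<^bsub>_\<^esub> _)" [66, 0, 66] 65)
  where
  "[] \<parallel>\<^bsub>cs\<^esub> [] = {[]}"
| "(e # u) \<parallel>\<^bsub>cs\<^esub> [] = (if e \<in> cs then {[]} else {[e]} \<frown> (u \<parallel>\<^bsub>cs\<^esub> []))"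
| "[] \<parallel>\<^bsub>cs\<^esub> (e # u) = (if e \<in> cs then {[]} else {[e]} \<frown> ([] \<parallel>\<^bsub>cs\<^esub> u))"
| "(e\<^sub>1 # u\<^sub>1) \<parallel>\<^bsub>cs\<^esub> (e\<^sub>2 # u\<^sub>2) =
    (if e\<^sub>1 = e\<^sub>2 then
       (if e\<^sub>1 \<in> cs then {[e\<^sub>1]} \<frown> (u\<^sub>1 \<parallel>\<^bsub>cs\<^esub> u\<^sub>2)
        else {[e\<^sub>1]} \<frown> ((u\<^sub>1 \<parallel>\<^bsub>cs\<^esub> (e\<^sub>2 # u\<^sub>2)) \<union> ((e\<^sub>1 # u\<^sub>1) \<parallel>\<^bsub>cs\<^esub> u\<^sub>2)))
     else if e\<^sub>1 \<in> cs \<and> e\<^sub>2 \<in> cs then {[]}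
     else if e\<^sub>1 \<in> cs then {[e\<^sub>2]} \<frown> ((e\<^sub>1 # u\<^sub>1) \<parallel>\<^bsub>cs\<^esub> u\<^sub>2)
     else if e\<^sub>2 \<in> cs then {[e\<^sub>1]} \<frown> (u\<^sub>1 \<parallel>\<^bsub>cs\<^esub> (e\<^sub>2 # u\<^sub>2))
     else ({[e\<^sub>2]} \<frown> ((e\<^sub>1 # u\<^sub>1) \<parallel>\<^bsub>cs\<^esub> u\<^sub>2)) \<union> ({[e\<^sub>1]} \<frown> (u\<^sub>1 \<parallel>\<^bsub>cs\<^esub> (e\<^sub>2 # u\<^sub>2))))"

definition trace_restrict :: "'e list \<Rightarrow> 'e set \<Rightarrow> 'e list"  (infixl "\<restriction>" 80)
  where "u \<restriction> cs = filter (\<lambda>e. e \<in> cs) u"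

section \<open>Parallel-by-merge\<close>

text \<open>A merge predicate relates the triple \<open>(x, 0.x, 1.x)\<close> to \<open>x'\<close>.\<close>

type_synonym ('s, 'e) mrel =
  "('s, 'e) obs \<times> ('s, 'e) obs \<times> ('s, 'e) obs \<Rightarrow> ('s, 'e) obs \<Rightarrow> bool"

definition par_by_merge :: "('s, 'e) mrel \<Rightarrow> ('s, 'e) rel \<Rightarrow> ('s, 'e) rel \<Rightarrow> ('s, 'e) rel"
  where "par_by_merge M P Q = (\<lambda>x (v, x\<^sub>0, x\<^sub>1). P x x\<^sub>0 \<and> Q x x\<^sub>1 \<and> v = x) OO M"

text \<open>The prefix conjuncts make explicit that the partial trace differences \<open>tt\<close>, \<open>0.tt\<close> and \<open>1.tt\<close>
  occurring in the merge predicate are defined. In particular the merged relation does not shorten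
  the trace.\<close>

definition merge_N :: "('u, 's) lens \<Rightarrow> 'e set \<Rightarrow> ('v, 's) lens \<Rightarrow> ('s, 'e) mrel"
  where "merge_N ns\<^sub>1 cs ns\<^sub>2 = (\<lambda>(x, x\<^sub>0, x\<^sub>1) x'.
           prefix (tr x) (tr x') \<and> prefix (tr x) (tr x\<^sub>0) \<and> prefix (tr x) (tr x\<^sub>1) \<and>
           tt x x' \<in> (tt x x\<^sub>0 \<parallel>\<^bsub>cs\<^esub> tt x x\<^sub>1) \<and>
           tt x x\<^sub>0 \<restriction> cs = tt x x\<^sub>1 \<restriction> cs \<and>
           ref x' \<subseteq> ((ref x\<^sub>0 \<union> ref x\<^sub>1) \<inter> cs) \<union> ((ref x\<^sub>0 \<inter> ref x\<^sub>1) - cs) \<and>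
           st x' = lens_override (lens_override (st x) ns\<^sub>1 (st x\<^sub>0)) ns\<^sub>2 (st x\<^sub>1))"

definition final_merge ::
  "('u, 's) lens \<Rightarrow> 'e set \<Rightarrow> ('v, 's) lens \<Rightarrow> ('s, 'e) rel \<Rightarrow> ('s, 'e) rel \<Rightarrow> ('s, 'e) rel"
  where "final_merge ns\<^sub>1 cs ns\<^sub>2 P Q =
           par_by_merge (\<lambda>m x'. \<exists>r. merge_N ns\<^sub>1 cs ns\<^sub>2 m (x'\<lparr>ref := r\<rparr>)) P Q"

end

theory Submission
  imports Defs
begin

text \<open>Both sides reduce to pointwise conditions on state and trace. By \<open>Phi_iff\<close>,
  \<open>\<Phi>\<close> is a guarded state update that appends a trace determined by the initial
  state. Each branch of the merge thus has a forced final trace and state, and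
  \<open>final_merge_Phi_iff\<close> eliminates the intermediate observations, leaving only the
  choice of a merged trace.\<close>

text \<open>The body mentions only \<open>st\<close> and \<open>tt\<close>, so hiding
  \<open>ok\<close>, \<open>wait\<close> and \<open>ref\<close> changes nothing. \<open>R2\<close>
  preserves \<open>tt\<close>, and the prefix condition of \<open>R1\<close> turns the equation on
  \<open>tt\<close> into an equation on \<open>tr x'\<close>.\<close>

lemma Phi_iff:
  "\<Phi> s \<sigma> t x x' \<longleftrightarrow> s (st x) \<and> st x' = \<sigma> (st x) \<and> tr x' = tr x @ t (st x)"
  by (auto simp: Phi_def CRR_def RR_def R1_def R2_def ucond_def tt_def trace_minus_def prefix_def)

text \<open>The refusals of \<open>\<Phi>\<close> are unconstrained, and the empty refusal set always satisfies the merge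
  predicate, so the hidden \<open>ref'\<close> imposes no condition.\<close>

lemma final_merge_Phi_iff:
  "final_merge ns\<^sub>1 cs ns\<^sub>2 (\<Phi> s\<^sub>1 \<sigma>\<^sub>1 t\<^sub>1) (\<Phi> s\<^sub>2 \<sigma>\<^sub>2 t\<^sub>2) x x' \<longleftrightarrow>
     s\<^sub>1 (st x) \<and> s\<^sub>2 (st x) \<and> st x' = st_merge ns\<^sub>1 ns\<^sub>2 \<sigma>\<^sub>1 \<sigma>\<^sub>2 (st x) \<and>
     t\<^sub>1 (st x) \<restriction> cs = t\<^sub>2 (st x) \<restriction> cs \<and>
     (\<exists>t \<in> t\<^sub>1 (st x) \<parallel>\<^bsub>cs\<^esub> t\<^sub>2 (st x). tr x' = tr x @ t)"
  (is "?L \<longleftrightarrow> ?R")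
proof
  assume ?L
  then show ?R
    by (auto simp: final_merge_def par_by_merge_def OO_def merge_N_def Phi_iff st_merge_def
        tt_def trace_minus_def prefix_def)
next
  assume R: ?R
  \<comment> \<open>The trace and state of each branch are forced by \<open>Phi_iff\<close>; the
    other fields are free and are copied from \<open>x\<close>.\<close>
  define x\<^sub>0 where "x\<^sub>0 = x\<lparr>tr := tr x @ t\<^sub>1 (st x), st := \<sigma>\<^sub>1 (st x)\<rparr>"
  define x\<^sub>1 where "x\<^sub>1 = x\<lparr>tr := tr x @ t\<^sub>2 (st x), st := \<sigma>\<^sub>2 (st x)\<rparr>"
  have "\<Phi> s\<^sub>1 \<sigma>\<^sub>1 t\<^sub>1 x x\<^sub>0" "\<Phi> s\<^sub>2 \<sigma>\<^sub>2 t\<^sub>2 x x\<^sub>1"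
    using R by (simp_all add: Phi_iff x\<^sub>0_def x\<^sub>1_def)
  moreover have "merge_N ns\<^sub>1 cs ns\<^sub>2 (x, x\<^sub>0, x\<^sub>1) (x'\<lparr>ref := {}\<rparr>)"
    using R by (auto simp: merge_N_def x\<^sub>0_def x\<^sub>1_def st_merge_def tt_def trace_minus_def)
  ultimately show ?L
    by (auto simp: final_merge_def par_by_merge_def OO_def)
qed

theorem theorem40:
  fixes ns\<^sub>1 :: "('u, 's) lens" and ns\<^sub>2 :: "('v, 's) lens" and cs :: "'e set"
    and s\<^sub>1 s\<^sub>2 :: "'s \<Rightarrow> bool" and \<sigma>\<^sub>1 \<sigma>\<^sub>2 :: "'s \<Rightarrow> 's" and t\<^sub>1 t\<^sub>2 :: "'s \<Rightarrow> 'e list"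
  assumes "is_lens ns\<^sub>1" and "is_lens ns\<^sub>2" and "ns\<^sub>1 \<bowtie> ns\<^sub>2"
  shows "(final_merge ns\<^sub>1 cs ns\<^sub>2 (\<Phi> s\<^sub>1 \<sigma>\<^sub>1 t\<^sub>1) (\<Phi> s\<^sub>2 \<sigma>\<^sub>2 t\<^sub>2) =
           (\<lambda>x x'. \<exists>t. \<Phi> (\<lambda>s. s\<^sub>1 s \<and> s\<^sub>2 s \<and> t \<in> (t\<^sub>1 s \<parallel>\<^bsub>cs\<^esub> t\<^sub>2 s) \<and> t\<^sub>1 s \<restriction> cs = t\<^sub>2 s \<restriction> cs)
                         (st_merge ns\<^sub>1 ns\<^sub>2 \<sigma>\<^sub>1 \<sigma>\<^sub>2) (\<lambda>s. t) x x')) \<and>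
         (final_merge ns\<^sub>1 cs ns\<^sub>2 (\<Phi> s\<^sub>1 \<sigma>\<^sub>1 (\<lambda>s. [])) (\<Phi> s\<^sub>2 \<sigma>\<^sub>2 (\<lambda>s. [])) =
           \<Phi> (\<lambda>s. s\<^sub>1 s \<and> s\<^sub>2 s) (st_merge ns\<^sub>1 ns\<^sub>2 \<sigma>\<^sub>1 \<sigma>\<^sub>2) (\<lambda>s. []))"
  \<comment> \<open>The bounded choice of a merged trace becomes the outer existential. For empty
    traces the only merge is \<open>[]\<close>, and the restrictions agree trivially.\<close>
  by (auto simp: fun_eq_iff final_merge_Phi_iff Phi_iff)

end
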